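(* Let $K$ be an antisymmetric $2\times 2$ matrix kernel on $\mathbb{Z}$ that represents a probability distribution on partitions, i.e. there is a random partition $\lambda$ such that for every finite $S\subset\mathbb{Z}$, $\Pr(S\subset\{\lambda_i-i:i\ge1\})=\mathrm{pf}(K(S))$. Let $\mathbb{Z}=N_+\uplus N_-$ be a decomposition such that $N_{+-}:=N_+\cap\mathbb{Z}^-$ and $N_{-+}:=N_-\cap\mathbb{N}$ are both finite. Then (whenever the Fredholm pfaffians involved are defined) \[ \mathrm{pf}\big(J-t^{1/4}(K-\chi_{N_-}J\chi_{N_-})t^{1/4}\big)_{\mathbb{Z}}=(1+\sqrt t)^{|N_{-+}|-|N_{+-}|}\,\mathrm{pf}\big(J-\sqrt t\,K\sqrt t\big)_{N_+}=(1-\sqrt t)^{|N_{+-}|-|N_{-+}|}\,\mathrm{pf}\big(J-\sqrt t\,(J-K)\sqrt t\big)_{N_-}. \]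
   Context: $\mathbb{N}=\{0,1,2,\dots\}$ and $\mathbb{Z}^-=\{-1,-2,\dots\}$. Partitions are $\lambda_1\ge\lambda_2\ge\cdots\ge0$ with finitely many nonzero parts. $J(a,b)=\delta_{ab}\begin{pmatrix}0&1\\-1&0\end{pmatrix}$. For a $2\times2$ antisymmetric matrix kernel $L$ on a set $N\subset\mathbb{Z}$ and finite $S=\{x_1,\dots,x_l\}$, $L(S)$ is the $2l\times 2l$ block matrix with blocks $L(x_i,x_j)$, $\mathrm{pf}(L(\emptyset))=1$, and the (discrete) Fredholm pfaffian is $\mathrm{pf}(J+L)_N:=\sum_{S\subset N\text{ finite}}\mathrm{pf}(L(S))$. $\chi_{N_-}$ is the projection onto $N_-$, so $\chi_{N_-}J\chi_{N_-}(a,b)=\delta_{ab}[a\in N_-]\begin{pmatrix}0&1\\-1&0\end{pmatrix}$. For a scalar $c$, $cLc$ denotes the kernel $c^2L$ (e.g. $t^{1/4}Lt^{1/4}=t^{1/2}L$, $\sqrt tL\sqrt t=tL$). *)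

theory Defs
  imports "HOL-Probability.Probability" "HOL-Combinatorics.Permutations"
begin

text \<open>The Pfaffian of the $2n \times 2n$ antisymmetric matrix with entries
  \<open>A i j\<close>, \<open>i, j < 2 * n\<close>.\<close>

definition pfaffian :: "nat \<Rightarrow> (nat \<Rightarrow> nat \<Rightarrow> complex) \<Rightarrow> complex" where
  "pfaffian n A =
     (\<Sum>p | p permutes {..<2 * n}. of_int (sign p) * (\<Prod>i<n. A (p (2 * i)) (p (2 * i + 1))))
       / (2 ^ n * fact n)"

type_synonym kern = "int \<Rightarrow> int \<Rightarrow> complex ^ 2 ^ 2"

definition antisym_kern :: "kern \<Rightarrow> bool" where
  "antisym_kern L \<longleftrightarrow> (\<forall>a b. L b a = - transpose (L a b))"

definition J :: kern where
  "J a b = (if a = b then vector [vector [0, 1], vector [-1, 0]] else 0)"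

definition proj_kern :: "int set \<Rightarrow> kern \<Rightarrow> kern" where
  "proj_kern N L a b = (if a \<in> N \<and> b \<in> N then L a b else 0)"

definition conj_kern :: "complex \<Rightarrow> kern \<Rightarrow> kern" where
  "conj_kern c L a b = (\<chi> i j. c * L a b $ i $ j * c)"

text \<open>The block matrix \<open>L(S)\<close>, with the points of \<open>S\<close> listed in increasing order (the Pfaffian
  does not depend on the order); entry \<open>(2k + r, 2m + s)\<close>, \<open>r, s \<in> {0, 1}\<close>, is entry
  \<open>(r + 1, s + 1)\<close> of the block \<open>L(x\<^sub>k, x\<^sub>m)\<close>.\<close>

definition block_mat :: "kern \<Rightarrow> int set \<Rightarrow> nat \<Rightarrow> nat \<Rightarrow> complex" where
  "block_mat L S i j =
     L (sorted_list_of_set S ! (i div 2)) (sorted_list_of_set S ! (j div 2))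
       $ (if even i then 1 else 2) $ (if even j then 1 else 2)"

definition pf :: "kern \<Rightarrow> int set \<Rightarrow> complex" where
  "pf L S = pfaffian (card S) (block_mat L S)"

text \<open>\<open>fredholm_pf L N\<close> is $\mathrm{pf}(J + L)_N$: the argument is \<open>L\<close>, not \<open>J + L\<close>. For
  complex terms, \<open>summable_on\<close> is absolute convergence.\<close>

definition fredholm_pf_defined :: "kern \<Rightarrow> int set \<Rightarrow> bool" where
  "fredholm_pf_defined L N \<longleftrightarrow> pf L summable_on {S. finite S \<and> S \<subseteq> N}"

definition fredholm_pf :: "kern \<Rightarrow> int set \<Rightarrow> complex" where
  "fredholm_pf L N = (\<Sum>\<^sub>\<infinity>S | finite S \<and> S \<subseteq> N. pf L S)"

text \<open>Partitions are indexed from 0: \<open>lam k\<close> is the part $\lambda_{k+1}$.\<close>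

definition int_partitions :: "(nat \<Rightarrow> nat) set" where
  "int_partitions = {lam. antimono lam \<and> finite {k. lam k \<noteq> 0}}"

definition point_config :: "(nat \<Rightarrow> nat) \<Rightarrow> int set" where
  "point_config lam = range (\<lambda>k. int (lam k) - int (k + 1))"

text \<open>There are countably many partitions, so a probability distribution on them is a probability
  mass function.\<close>

definition represents_partition_distribution :: "kern \<Rightarrow> bool" where
  "represents_partition_distribution K \<longleftrightarrow>
     (\<exists>P :: (nat \<Rightarrow> nat) pmf. set_pmf P \<subseteq> int_partitions \<and>
        (\<forall>S. finite S \<longrightarrow>
           complex_of_real (measure_pmf.prob P {lam. S \<subseteq> point_config lam}) = pf K S))"

end

theory Submission
  imports Defs
begin

text \<open>
  Let \<open>X\<close> be the random point configuration. Adding \<open>c\<close> times the \<open>J\<close>-block at \<open>x\<close> to a kernel \<open>L\<close> changes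
  \<open>pf L S\<close> by \<open>c * pf L (S - {x})\<close>; hence \<open>pf (K - proj_kern N J) S\<close> is the expectation of the product
  over \<open>x \<in> S\<close> of \<open>[x \<in> X] - [x \<in> N]\<close>. For fixed \<open>S\<close> this product has the sign \<open>(-1) ^ card (S \<inter> N)\<close>
  wherever it does not vanish, so there is no cancellation inside the expectation and absolute
  convergence of the Fredholm series justifies exchanging it with the expectation. With
  \<open>m = card (X \<inter> N_plus)\<close>, \<open>n = card (N_minus - X)\<close> and \<open>s = csqrt t\<close>, the three Fredholm Pfaffians
  become the expectations of \<open>(1 - s) ^ m * (1 + s) ^ n\<close>, \<open>(1 - t) ^ m\<close> and \<open>(1 - t) ^ n\<close>. Since a
  partition has charge zero, \<open>m - n\<close> is the constant \<open>card N_pm - card N_mp\<close>, and the identities hold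
  termwise.
\<close>

section \<open>First-order expansion of Pfaffian sums in a diagonal block\<close>

text \<open>The unnormalised Pfaffian with rows and columns indexed by \<open>S \<times> bool\<close> instead of \<open>{..<2 * n}\<close>,
  which makes removing a point of \<open>S\<close> free of reindexing.\<close>

definition pf_sum :: "('a \<times> bool \<Rightarrow> 'a \<times> bool \<Rightarrow> complex) \<Rightarrow> 'a set \<Rightarrow> complex" where
  "pf_sum A S =
     (\<Sum>p | p permutes S \<times> UNIV. of_int (sign p) * (\<Prod>x\<in>S. A (p (x, False)) (p (x, True))))"

text \<open>Antisymmetrised as \<open>unit_block x u v - unit_block x v u\<close>, this is the
  \<open>J\<close>-block at \<open>x\<close>, with \<open>False\<close> and \<open>True\<close>
  standing for the components 1 and 2.\<close>

definition unit_block :: "'a \<Rightarrow> 'a \<times> bool \<Rightarrow> 'a \<times> bool \<Rightarrow> complex" where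
  "unit_block x u v = of_bool (u = (x, False) \<and> v = (x, True))"

text \<open>Every term of the expanded product with two factors \<open>g\<close> vanishes, so the
  expansion stops at first order.\<close>

lemma prod_add_orthogonal:
  fixes f g :: "'a \<Rightarrow> 'b :: comm_ring_1"
  assumes "finite A" and "\<And>x y. x \<in> A \<Longrightarrow> y \<in> A \<Longrightarrow> x \<noteq> y \<Longrightarrow> g x * g y = 0"
  shows "(\<Prod>x\<in>A. f x + g x) = (\<Prod>x\<in>A. f x) + (\<Sum>x\<in>A. g x * (\<Prod>y\<in>A - {x}. f y))"
  using assms
proof (induction A rule: finite_induct)
  case empty
  then show ?case by simp
next
  case (insert a A)
  have zero: "g a * (\<Sum>x\<in>A. g x * (\<Prod>y\<in>A - {x}. f y)) = 0"
    unfolding sum_distrib_left mult.assoc[symmetric] using insert.prems insert.hyps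
    by (intro sum.neutral) (metis insertCI mult_zero_left)
  have rest: "(\<Prod>y\<in>insert a A - {x}. f y) = f a * (\<Prod>y\<in>A - {x}. f y)" if "x \<in> A" for x
  proof -
    have "insert a A - {x} = insert a (A - {x})" using that insert.hyps by auto
    then show ?thesis using insert.hyps by simp
  qed
  have "(\<Prod>x\<in>insert a A. f x + g x)
      = (f a + g a) * ((\<Prod>x\<in>A. f x) + (\<Sum>x\<in>A. g x * (\<Prod>y\<in>A - {x}. f y)))"
    using insert by simp
  also have "\<dots> = f a * (\<Prod>x\<in>A. f x) + g a * (\<Prod>x\<in>A. f x)
      + f a * (\<Sum>x\<in>A. g x * (\<Prod>y\<in>A - {x}. f y))"
    using zero by (simp add: algebra_simps)
  also have "f a * (\<Sum>x\<in>A. g x * (\<Prod>y\<in>A - {x}. f y))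
      = (\<Sum>x\<in>A. g x * (\<Prod>y\<in>insert a A - {x}. f y))"
    unfolding sum_distrib_left by (intro sum.cong) (auto simp: rest mult_ac)
  finally show ?case using insert.hyps by (simp add: algebra_simps)
qed

text \<open>The block factor is nonzero only if \<open>p\<close> fixes both indices over
  \<open>x\<close>, so exactly the permutations of \<open>S \<times> UNIV\<close> survive.\<close>

lemma pf_sum_fixing_block:
  assumes "finite S" "x \<notin> S"
  shows "(\<Sum>p | p permutes insert x S \<times> UNIV. of_int (sign p) *
            (unit_block x (p (x, False)) (p (x, True)) * (\<Prod>z\<in>S. A (p (z, False)) (p (z, True)))))
         = pf_sum A S"
proof -
  have sub: "p permutes insert x S \<times> UNIV" if "p permutes S \<times> UNIV" for p :: "'a \<times> bool \<Rightarrow> _"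
    using that by (rule permutes_subset) auto
  have fixx: "p (x, b) = (x, b)" if "p permutes S \<times> UNIV" for p :: "'a \<times> bool \<Rightarrow> _" and b
    using that assms by (intro permutes_not_in) auto
  have restr: "p permutes S \<times> UNIV"
    if "p permutes insert x S \<times> UNIV" "p (x, False) = (x, False)" "p (x, True) = (x, True)"
    for p :: "'a \<times> bool \<Rightarrow> _"
    using that(1)
  proof (rule permutes_superset)
    fix u :: "'a \<times> bool" assume "u \<in> insert x S \<times> UNIV - S \<times> UNIV"
    then have "fst u = x" by auto
    then have "u = (x, False) \<or> u = (x, True)" by (cases u) auto
    then show "p u = u" using that(2,3) by blast
  qed
  show ?thesis unfolding pf_sum_def
  proof (rule sum.mono_neutral_cong_right)
    show "finite {p. p permutes insert x S \<times> (UNIV :: bool set)}"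
      using assms by (intro finite_permutations) simp
    show "{p. p permutes S \<times> (UNIV :: bool set)} \<subseteq> {p. p permutes insert x S \<times> UNIV}"
      using sub by blast
  qed (use restr in \<open>auto simp: unit_block_def fixx\<close>)
qed

text \<open>Precomposing with the transposition of the two indices over \<open>x\<close> reduces
  this to the fixing case and flips every sign.\<close>

lemma pf_sum_swapping_block:
  assumes "finite S" "x \<notin> S"
  shows "(\<Sum>p | p permutes insert x S \<times> UNIV. of_int (sign p) *
            (unit_block x (p (x, True)) (p (x, False)) * (\<Prod>z\<in>S. A (p (z, False)) (p (z, True)))))
         = - pf_sum A S"
proof -
  let ?r = "Transposition.transpose (x, False) (x, True)"
  have r: "?r permutes insert x S \<times> UNIV" by (rule permutes_swap_id) auto
  have rS: "?r (z, b) = (z, b)" if "z \<in> S" for z b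
    using that assms by (auto simp: Transposition.transpose_def)
  have sgn: "sign (p \<circ> ?r) = - sign p" if "p permutes insert x S \<times> UNIV" for p
    using permutes_imp_permutation[OF _ that] assms
    by (subst sign_compose) (simp_all add: sign_swap_id permutation_swap_id)
  show ?thesis
    by (subst sum_permutations_compose_right[OF r])
      (simp add: sgn rS sum_negf pf_sum_fixing_block[OF assms, symmetric] cong: prod.cong)
qed

text \<open>The new block can occupy any of the \<open>card (insert x S)\<close> factors, in either
  orientation, and all these choices contribute equally. This explains the coefficient, which the
  normalisation of the Pfaffian later absorbs.\<close>

lemma pf_sum_add_diagonal_block:
  assumes "finite S" "x \<notin> S"
  shows "pf_sum (\<lambda>u v. A u v + c * (unit_block x u v - unit_block x v u)) (insert x S)
         = pf_sum A (insert x S) + 2 * of_nat (card (insert x S)) * c * pf_sum A S"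
proof -
  define E :: "'a \<times> bool \<Rightarrow> 'a \<times> bool \<Rightarrow> complex"
    where "E u v = unit_block x u v - unit_block x v u" for u v
  define T where "T = insert x S"
  have T: "finite T" "x \<in> T" using assms by (auto simp: T_def)
  define P where "P = {p :: 'a \<times> bool \<Rightarrow> 'a \<times> bool. p permutes T \<times> UNIV}"
  define F where "F y p = of_int (sign p) *
      (E (p (y, False)) (p (y, True)) * (\<Prod>z\<in>T - {y}. A (p (z, False)) (p (z, True))))" for y p
  \<comment> \<open>A nonzero \<open>E\<close>-factor at \<open>y\<close> means that
    \<open>p\<close> sends an index over \<open>y\<close> to \<open>(x, False)\<close>. As
    \<open>p\<close> is injective, this happens for at most one \<open>y\<close>.\<close>
  have expand: "(\<Prod>y\<in>T. A (p (y, False)) (p (y, True)) + c * E (p (y, False)) (p (y, True)))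
      = (\<Prod>y\<in>T. A (p (y, False)) (p (y, True)))
        + (\<Sum>y\<in>T. (c * E (p (y, False)) (p (y, True))) *
             (\<Prod>z\<in>T - {y}. A (p (z, False)) (p (z, True))))" if "p \<in> P" for p
  proof (rule prod_add_orthogonal)
    fix y z :: 'a assume "y \<noteq> z"
    have "inj p" using that by (auto simp: P_def intro: permutes_inj)
    then have "p (y, a) \<noteq> p (z, b)" for a b using \<open>y \<noteq> z\<close> by (simp add: inj_eq)
    moreover have "\<exists>b. p (w, b) = (x, False)" if "E (p (w, False)) (p (w, True)) \<noteq> 0" for w
      using that by (cases "p (w, False) = (x, False)"; cases "p (w, True) = (x, False)")
        (auto simp: E_def unit_block_def)
    ultimately have "E (p (y, False)) (p (y, True)) = 0 \<or> E (p (z, False)) (p (z, True)) = 0"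
      by metis
    then show "c * E (p (y, False)) (p (y, True)) * (c * E (p (z, False)) (p (z, True))) = 0"
      by auto
  qed (use T in auto)
  have swap: "(\<Sum>p\<in>P. F y p) = (\<Sum>p\<in>P. F x p)" if "y \<in> T" for y
  proof (cases "y = x")
    case False
    \<comment> \<open>\<open>q\<close> exchanges the points \<open>x\<close> and \<open>y\<close> in
      both components. Being a product of two transpositions it is even, so it carries the terms for
      \<open>y\<close> to those for \<open>x\<close> without a sign.\<close>
    define q where "q = Transposition.transpose (x, False) (y, False) \<circ>
      Transposition.transpose (x, True) (y, True)"
    have q: "q permutes T \<times> UNIV" unfolding q_def
      using that T by (intro permutes_compose permutes_swap_id) auto
    have qz: "q (z, b) = (Transposition.transpose x y z, b)" for z b
      by (cases b) (auto simp: q_def Transposition.transpose_def)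
    have "sign q = 1" unfolding q_def using False
      by (subst sign_compose) (auto simp: sign_swap_id permutation_swap_id)
    moreover have "permutation r" if "r \<in> P" for r
      using that T permutes_imp_permutation[of "T \<times> UNIV" r] by (simp add: P_def)
    ultimately have sgn: "sign (p \<circ> q) = sign p" if "p \<in> P" for p
      using that q by (subst sign_compose) (simp_all add: P_def)
    have bij: "bij_betw (Transposition.transpose x y) (T - {y}) (T - {x})"
      by (rule bij_betwI[where g = "Transposition.transpose x y"])
        (use that T in \<open>auto simp: Transposition.transpose_def split: if_splits\<close>)
    have "F y (p \<circ> q) = F x p" if "p \<in> P" for p
      using sgn[OF that] prod.reindex_bij_betw[OF bij, of "\<lambda>z. A (p (z, False)) (p (z, True))"]
      by (simp add: F_def qz)
    then show ?thesis
      using sum_permutations_compose_right[OF q, of "F y"] by (simp add: P_def)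
  qed simp
  \<comment> \<open>The sign of the swapped orientation cancels the minus sign in \<open>E\<close>,
    so the two orientations add up.\<close>
  have Fx: "(\<Sum>p\<in>P. F x p) = 2 * pf_sum A S"
    using pf_sum_fixing_block[OF assms, of A] pf_sum_swapping_block[OF assms, of A] assms
    by (simp add: F_def P_def T_def E_def algebra_simps sum_subtractf)
  have "pf_sum (\<lambda>u v. A u v + c * E u v) T
      = (\<Sum>p\<in>P. of_int (sign p) * (\<Prod>y\<in>T. A (p (y, False)) (p (y, True))) + c * (\<Sum>y\<in>T. F y p))"
    unfolding pf_sum_def P_def[symmetric]
    by (intro sum.cong refl, simp only: expand)
      (simp add: F_def sum_distrib_left distrib_left mult_ac)
  also have "\<dots> = pf_sum A T + c * (\<Sum>y\<in>T. \<Sum>p\<in>P. F y p)"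
    unfolding sum.distrib sum_distrib_left[symmetric] pf_sum_def P_def[symmetric]
    by (subst sum.swap) (rule refl)
  also have "\<dots> = pf_sum A T + 2 * of_nat (card T) * c * pf_sum A S"
    by (simp add: swap Fx)
  finally show ?thesis unfolding E_def T_def .
qed

section \<open>Pfaffians of kernels\<close>

definition kern_entry :: "kern \<Rightarrow> int \<times> bool \<Rightarrow> int \<times> bool \<Rightarrow> complex" where
  "kern_entry L u v = L (fst u) (fst v) $ (if snd u then 2 else 1) $ (if snd v then 2 else 1)"

text \<open>The row numbering of \<open>block_mat\<close> is a bijection of \<open>{..<2*n}\<close>
  onto \<open>S \<times> UNIV\<close>, and relabelling permutations along it preserves signs and
  products.\<close>

lemma pf_eq_pf_sum:
  assumes "finite S"
  shows "pf L S = pf_sum (kern_entry L) S / (2 ^ card S * fact (card S))"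
proof -
  define n where "n = card S"
  define l where "l = sorted_list_of_set S"
  define e where "e i = (l ! (i div 2), odd i)" for i :: nat
  have l: "length l = n" "set l = S" "distinct l" using assms by (auto simp: l_def n_def)
  have lb: "bij_betw (\<lambda>i. l ! i) {..<n} S" using bij_betw_nth[OF l(3)] l by simp
  have inj: "inj_on e {..<2*n}"
  proof (rule inj_onI)
    fix i j assume "i \<in> {..<2*n}" "j \<in> {..<2*n}" "e i = e j"
    then have "i div 2 = j div 2" "odd i = odd j"
      using l by (auto simp: e_def nth_eq_iff_index_eq)
    then show "i = j" by presburger
  qed
  have im: "e ` {..<2*n} = S \<times> UNIV"
  proof
    show "e ` {..<2*n} \<subseteq> S \<times> UNIV" using l by (auto simp: e_def)
    show "S \<times> UNIV \<subseteq> e ` {..<2*n}"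
    proof
      fix u :: "int \<times> bool" assume "u \<in> S \<times> UNIV"
      then obtain k where k: "k < n" "fst u = l ! k" using l by (auto simp: in_set_conv_nth)
      then have "u = e (2 * k + of_bool (snd u))" by (cases u) (auto simp: e_def)
      then show "u \<in> e ` {..<2*n}" using k by (intro image_eqI) auto
    qed
  qed
  have e: "bij_betw e {..<2*n} (S \<times> UNIV)" using inj im by (auto simp: bij_betw_def)
  have entry: "block_mat L S i j = kern_entry L (e i) (e j)" for i j
    by (simp add: block_mat_def kern_entry_def e_def l_def)
  define m where "m = map_permutation {..<2*n} e"
  define m' where "m' = map_permutation (S \<times> UNIV) (inv_into {..<2*n} e)"
  have "(\<Sum>p | p permutes {..<2*n}. of_int (sign p) *
            (\<Prod>i<n. block_mat L S (p (2 * i)) (p (2 * i + 1)))) = pf_sum (kern_entry L) S"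
    unfolding pf_sum_def
  proof (rule sum.reindex_bij_witness[where i = m' and j = m])
    fix p :: "nat \<Rightarrow> nat" assume "p \<in> {p. p permutes {..<2*n}}"
    then have p: "p permutes {..<2*n}" by simp
    show "m' (m p) = p" unfolding m_def m'_def using e p
      by (rule map_permutation_compose_inv) (use inj in auto)
    show "m p \<in> {p. p permutes S \<times> UNIV}" unfolding m_def
      using map_permutation_permutes[OF e p] by simp
    have app: "m p (e i) = e (p i)" if "i < 2 * n" for i
      unfolding m_def using inj that by (intro map_permutation_apply) auto
    have "(\<Prod>x\<in>S. kern_entry L (m p (x, False)) (m p (x, True)))
        = (\<Prod>i<n. kern_entry L (m p (l ! i, False)) (m p (l ! i, True)))"
      by (rule prod.reindex_bij_betw[OF lb, symmetric])
    also have "\<dots> = (\<Prod>i<n. block_mat L S (p (2 * i)) (p (2 * i + 1)))"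
    proof (rule prod.cong[OF refl])
      fix i assume "i \<in> {..<n}"
      then have "m p (l ! i, False) = e (p (2 * i))" "m p (l ! i, True) = e (p (2 * i + 1))"
        using app[of "2 * i"] app[of "2 * i + 1"] by (auto simp: e_def)
      then show "kern_entry L (m p (l ! i, False)) (m p (l ! i, True))
          = block_mat L S (p (2 * i)) (p (2 * i + 1))" by (simp add: entry)
    qed
    finally show "of_int (sign (m p)) * (\<Prod>x\<in>S. kern_entry L (m p (x, False)) (m p (x, True)))
        = of_int (sign p) * (\<Prod>i<n. block_mat L S (p (2 * i)) (p (2 * i + 1)))"
      using sign_map_permutation[OF inj p] by (simp add: m_def)
  next
    fix p :: "int \<times> bool \<Rightarrow> _" assume "p \<in> {p. p permutes S \<times> UNIV}"
    then have p: "p permutes S \<times> UNIV" by simp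
    have e': "bij_betw (inv_into {..<2*n} e) (S \<times> UNIV) {..<2*n}"
      by (rule bij_betw_inv_into[OF e])
    show "m (m' p) = p" unfolding m_def m'_def using e' p
      by (rule map_permutation_compose_inv) (use im in \<open>metis f_inv_into_f\<close>)
    show "m' p \<in> {p. p permutes {..<2*n}}" unfolding m'_def
      using map_permutation_permutes[OF e' p] by simp
  qed
  then show ?thesis by (simp add: pf_def pfaffian_def n_def)
qed

lemma pf_cong:
  assumes "finite S" "\<And>a b. a \<in> S \<Longrightarrow> b \<in> S \<Longrightarrow> L a b = L' a b"
  shows "pf L S = pf L' S"
proof -
  have "p (x, b) \<in> S \<times> UNIV" if "p permutes S \<times> UNIV" "x \<in> S" for p and x :: int and b :: bool
    using permutes_in_image[OF that(1), of "(x, b)"] that(2) by simp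
  then have "pf_sum (kern_entry L) S = pf_sum (kern_entry L') S"
    unfolding pf_sum_def kern_entry_def using assms
    by (intro sum.cong refl arg_cong2[of _ _ _ _ "(*)"] prod.cong) (simp_all add: mem_Times_iff)
  then show ?thesis using assms by (simp add: pf_eq_pf_sum)
qed

text \<open>Each term of the Pfaffian has one entry per point, so the degree is
  \<open>card S\<close> and not \<open>2 * card S\<close>.\<close>

lemma pf_scale:
  assumes "finite S" "\<And>a b i j. L' a b $ i $ j = c * L a b $ i $ j"
  shows "pf L' S = c ^ card S * pf L S"
proof -
  have "pf_sum (kern_entry L') S = c ^ card S * pf_sum (kern_entry L) S"
    unfolding pf_sum_def sum_distrib_left
    by (intro sum.cong refl) (simp add: kern_entry_def assms prod.distrib)
  then show ?thesis using assms by (simp add: pf_eq_pf_sum)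
qed

text \<open>\<open>2 * card S\<close> is the quotient of the normalising constants for
  \<open>S\<close> and \<open>S - {x}\<close>, so only the factor \<open>c\<close> remains.\<close>

lemma pf_add_diagonal_block:
  assumes "finite S" "x \<in> S"
    and "\<And>a b. L' a b = L a b + (if a = x \<and> b = x then (\<chi> i j. c * J x x $ i $ j) else 0)"
  shows "pf L' S = pf L S + c * pf L (S - {x})"
proof -
  have S: "insert x (S - {x}) = S" "finite (S - {x})" using assms by auto
  have "kern_entry L' u v = kern_entry L u v + c * (unit_block x u v - unit_block x v u)" for u v
    by (cases u; cases v) (auto simp: kern_entry_def assms(3) unit_block_def J_def)
  then have "kern_entry L' = (\<lambda>u v. kern_entry L u v + c * (unit_block x u v - unit_block x v u))"
    by (intro ext)
  then have "pf_sum (kern_entry L') S = pf_sum (kern_entry L) S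
      + 2 * of_nat (card S) * c * pf_sum (kern_entry L) (S - {x})"
    using pf_sum_add_diagonal_block[OF S(2), of x "kern_entry L" c] S by simp
  moreover obtain k where k: "card S = Suc k" "card (S - {x}) = k"
    using assms card.remove[of S x] by blast
  moreover have "(a + 2 * of_nat (Suc k) * c * b) / (2 ^ Suc k * fact (Suc k))
      = a / (2 ^ Suc k * fact (Suc k)) + c * (b / (2 ^ k * fact k))" for a b :: complex
  proof -
    \<comment> \<open>\<open>d\<close>, \<open>w\<close> and \<open>f\<close> stand for
      \<open>Suc k\<close>, \<open>2 ^ k\<close> and \<open>fact k\<close>; only their nonvanishing
      matters.\<close>
    have "(a + 2 * d * c * b) / (2 * w * (d * f)) = a / (2 * w * (d * f)) + c * (b / (w * f))"
      if "d \<noteq> 0" "w \<noteq> 0" "f \<noteq> 0" for d w f :: complex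
      using that by (simp add: field_simps)
    then show ?thesis
      unfolding fact_Suc power_Suc by (simp del: of_nat_Suc)
  qed
  ultimately show ?thesis
    unfolding pf_eq_pf_sum[OF assms(1)] pf_eq_pf_sum[OF S(2)] k by (simp only:)
qed

section \<open>Pfaffians of shifted kernels as expectations\<close>

text \<open>Induction on \<open>F\<close>: for \<open>y \<in> S\<close>, adding \<open>y\<close> to
  \<open>F\<close> subtracts the \<open>J\<close>-block at \<open>y\<close> and hence the Pfaffian
  over \<open>S - {y}\<close>. In the expectation the factor at \<open>y\<close> drops by 1, which
  yields the same recursion.\<close>

lemma pf_minus_finite_projection:
  fixes P :: "'a pmf" and X :: "'a \<Rightarrow> int set"
  assumes "\<And>S. finite S \<Longrightarrow> complex_of_real (measure_pmf.prob P {\<omega>. S \<subseteq> X \<omega>}) = pf K S"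
    and "finite F" and "finite S"
  shows "pf (K - proj_kern F J) S = complex_of_real
    (measure_pmf.expectation P (\<lambda>\<omega>. \<Prod>x\<in>S. of_bool (x \<in> X \<omega>) - of_bool (x \<in> F)))"
  using assms(2,3)
proof (induction F arbitrary: S rule: finite_induct)
  case empty
  have "pf (K - proj_kern {} J) S = pf K S"
    using empty by (intro pf_cong) (simp_all add: proj_kern_def)
  also have "\<dots> = complex_of_real (measure_pmf.expectation P (indicator {\<omega>. S \<subseteq> X \<omega>}))"
    using assms(1)[OF empty] by simp
  also have "indicator {\<omega>. S \<subseteq> X \<omega>} = (\<lambda>\<omega>. \<Prod>x\<in>S. of_bool (x \<in> X \<omega>) - of_bool (x \<in> {}) :: real)"
  proof
    fix \<omega>
    show "indicator {\<omega>. S \<subseteq> X \<omega>} \<omega> = (\<Prod>x\<in>S. of_bool (x \<in> X \<omega>) - of_bool (x \<in> {}) :: real)"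
      using empty by (cases "S \<subseteq> X \<omega>") (auto simp: indicator_def intro!: prod.neutral)
  qed
  finally show ?case .
next
  case (insert y F)
  let ?E = "\<lambda>S \<omega>. \<Prod>x\<in>S. of_bool (x \<in> X \<omega>) - of_bool (x \<in> F) :: real"
  let ?E' = "\<lambda>S \<omega>. \<Prod>x\<in>S. of_bool (x \<in> X \<omega>) - of_bool (x \<in> insert y F) :: real"
  show ?case
  proof (cases "y \<in> S")
    case False
    have "pf (K - proj_kern (insert y F) J) S = pf (K - proj_kern F J) S"
      using False insert.prems by (intro pf_cong) (auto simp: proj_kern_def)
    moreover have "?E' S = ?E S" using False by (intro ext prod.cong) auto
    ultimately show ?thesis using insert.IH[OF insert.prems] by metis
  next
    case True
    \<comment> \<open>Every factor is -1, 0 or 1.\<close>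
    have int: "integrable (measure_pmf P) (?E T)" for T
      by (rule measure_pmf.integrable_const_bound[where B = 1])
        (auto simp: abs_prod intro!: AE_I2 prod_le_1)
    have "(K - proj_kern (insert y F) J) a b
        = (K - proj_kern F J) a b + (if a = y \<and> b = y then (\<chi> i j. - 1 * J y y $ i $ j) else 0)"
      for a b using insert.hyps by (auto simp: proj_kern_def J_def vec_eq_iff)
    then have "pf (K - proj_kern (insert y F) J) S
        = pf (K - proj_kern F J) S + - 1 * pf (K - proj_kern F J) (S - {y})"
      using insert.prems True by (intro pf_add_diagonal_block) auto
    also have "\<dots> = complex_of_real (measure_pmf.expectation P (\<lambda>\<omega>. ?E S \<omega> - ?E (S - {y}) \<omega>))"
      unfolding insert.IH[OF insert.prems] insert.IH[OF finite_Diff[OF insert.prems]]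
        Bochner_Integration.integral_diff[OF int int] by simp
    also have "(\<lambda>\<omega>. ?E S \<omega> - ?E (S - {y}) \<omega>) = ?E' S"
    proof
      fix \<omega>
      have "(\<Prod>x\<in>S - {y}. of_bool (x \<in> X \<omega>) - of_bool (x \<in> insert y F) :: real) = ?E (S - {y}) \<omega>"
        by (intro prod.cong) auto
      then show "?E S \<omega> - ?E (S - {y}) \<omega> = ?E' S \<omega>"
        unfolding prod.remove[OF insert.prems True] using insert.hyps by (simp add: algebra_simps)
    qed
    finally show ?thesis .
  qed
qed

text \<open>For a given \<open>S\<close> only \<open>N \<inter> S\<close> matters, so the finite
  case covers infinite \<open>N\<close>. A factor of the product vanishes unless its point lies in
  exactly one of \<open>X \<omega>\<close> and \<open>N\<close>; otherwise its sign depends on the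
  point alone.\<close>

lemma pf_minus_projection:
  fixes P :: "'a pmf" and X :: "'a \<Rightarrow> int set"
  assumes "\<And>S. finite S \<Longrightarrow> complex_of_real (measure_pmf.prob P {\<omega>. S \<subseteq> X \<omega>}) = pf K S"
    and "finite S"
  shows "pf (K - proj_kern N J) S
    = (\<Prod>x\<in>S. if x \<in> N then - 1 else 1) *
      complex_of_real (measure_pmf.prob P {\<omega>. S \<subseteq> (X \<omega> - N) \<union> (N - X \<omega>)})"
proof -
  let ?\<epsilon> = "\<lambda>x. if x \<in> N then - 1 else 1 :: real"
  let ?A = "{\<omega>. S \<subseteq> (X \<omega> - N) \<union> (N - X \<omega>)}"
  have "pf (K - proj_kern N J) S = pf (K - proj_kern (N \<inter> S) J) S"
    using assms(2) by (intro pf_cong) (auto simp: proj_kern_def)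
  also have "\<dots> = complex_of_real
      (measure_pmf.expectation P (\<lambda>\<omega>. \<Prod>x\<in>S. of_bool (x \<in> X \<omega>) - of_bool (x \<in> N \<inter> S)))"
    using assms by (intro pf_minus_finite_projection) auto
  also have "(\<lambda>\<omega>. \<Prod>x\<in>S. of_bool (x \<in> X \<omega>) - of_bool (x \<in> N \<inter> S)) = (\<lambda>\<omega>. (\<Prod>x\<in>S. ?\<epsilon> x) * indicator ?A \<omega>)"
  proof
    fix \<omega>
    show "(\<Prod>x\<in>S. of_bool (x \<in> X \<omega>) - of_bool (x \<in> N \<inter> S)) = (\<Prod>x\<in>S. ?\<epsilon> x) * indicator ?A \<omega>"
    proof (cases "\<omega> \<in> ?A")
      case True
      then show ?thesis by (auto intro!: prod.cong)
    next
      case False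
      then show ?thesis using assms(2) by (auto intro!: prod_zero)
    qed
  qed
  also have "complex_of_real (measure_pmf.expectation P (\<lambda>\<omega>. (\<Prod>x\<in>S. ?\<epsilon> x) * indicator ?A \<omega>))
      = (\<Prod>x\<in>S. if x \<in> N then - 1 else 1) * complex_of_real (measure_pmf.prob P ?A)"
    by (simp add: if_distrib[of complex_of_real] cong: if_cong)
  finally show ?thesis .
qed

section \<open>Fredholm Pfaffians as expectations\<close>

text \<open>Turns a probability into a series over the support, so that exchanging expectation and
  Fredholm sum becomes exchanging two series.\<close>

lemma has_sum_prob_pmf:
  "((\<lambda>\<omega>. pmf P \<omega> * of_bool (\<omega> \<in> A)) has_sum measure_pmf.prob P A) (set_pmf P)"
proof -
  have "pmf P summable_on A"
    using pmf_abs_summable[of P A] abs_summable_equivalent[of "pmf P" A] by simp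
  moreover have "infsum (pmf P) A = measure_pmf.prob P A"
    by (simp add: measure_pmf_conv_infsetsum infsetsum_infsum pmf_abs_summable)
  ultimately have "(pmf P has_sum measure_pmf.prob P A) A"
    using has_sum_infsum by metis
  then show ?thesis
    by (rule has_sum_cong_neutral[THEN iffD1, rotated -1]) (auto simp: set_pmf_iff)
qed

text \<open>After the exchange the inner sum runs over the subsets of the finite set
  \<open>D \<omega> \<inter> M\<close>, where the sum of the products of \<open>w\<close> factors
  into terms \<open>1 + w x\<close>.\<close>

lemma fredholm_pf_eq_expectation:
  fixes P :: "'a pmf" and D :: "'a \<Rightarrow> int set"
  assumes pf: "\<And>S. finite S \<Longrightarrow> pf L S = (\<Prod>x\<in>S. w x) * complex_of_real (measure_pmf.prob P {\<omega>. S \<subseteq> D \<omega>})"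
    and "fredholm_pf_defined L M"
    and fin: "\<And>\<omega>. \<omega> \<in> set_pmf P \<Longrightarrow> finite (D \<omega> \<inter> M)"
  shows "fredholm_pf L M = (\<Sum>\<^sub>\<infinity>\<omega>\<in>set_pmf P. complex_of_real (pmf P \<omega>) * (\<Prod>x\<in>D \<omega> \<inter> M. 1 + w x))"
proof -
  define I where "I = {S. finite S \<and> S \<subseteq> M}"
  define f where "f S \<omega> = (\<Prod>x\<in>S. w x) * complex_of_real (pmf P \<omega> * of_bool (S \<subseteq> D \<omega>))" for S \<omega>
  have sums: "(f S has_sum pf L S) (set_pmf P)" if "S \<in> I" for S
    using has_sum_cmult_right[OF has_sum_of_real[OF has_sum_prob_pmf[of P "{\<omega>. S \<subseteq> D \<omega>}"]], of "\<Prod>x\<in>S. w x"]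
      pf[of S] that by (simp add: f_def[abs_def] I_def)
  \<comment> \<open>For fixed \<open>S\<close> all \<open>f S \<omega>\<close> are nonnegative
    multiples of one complex number, so their norms sum to exactly \<open>norm (pf L S)\<close>.
    Thus convergence of the Fredholm series gives absolute convergence of the double series.\<close>
  have norms: "((\<lambda>\<omega>. norm (f S \<omega>)) has_sum norm (pf L S)) (set_pmf P)" if "S \<in> I" for S
    using has_sum_cmult_right[OF has_sum_prob_pmf[of P "{\<omega>. S \<subseteq> D \<omega>}"], of "norm (\<Prod>x\<in>S. w x)"]
      pf[of S] that by (simp add: f_def[abs_def] I_def norm_mult)
  have "(\<lambda>S. norm (pf L S)) summable_on I"
    using assms(2) by (simp add: fredholm_pf_defined_def I_def summable_on_iff_abs_summable_on_complex)
  then have "(\<lambda>(S, \<omega>). norm (f S \<omega>)) summable_on (I \<times> set_pmf P)"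
    using norms by (intro summable_on_SigmaI[where g = "\<lambda>S. norm (pf L S)"]) auto
  then have "(\<lambda>(S, \<omega>). f S \<omega>) summable_on (I \<times> set_pmf P)"
    by (intro abs_summable_summable[of "\<lambda>(S, \<omega>). f S \<omega>"]) (simp add: case_prod_unfold)
  then have "(\<Sum>\<^sub>\<infinity>S\<in>I. \<Sum>\<^sub>\<infinity>\<omega>\<in>set_pmf P. f S \<omega>) = (\<Sum>\<^sub>\<infinity>\<omega>\<in>set_pmf P. \<Sum>\<^sub>\<infinity>S\<in>I. f S \<omega>)"
    by (rule infsum_swap_banach)
  moreover have "(\<Sum>\<^sub>\<infinity>S\<in>I. \<Sum>\<^sub>\<infinity>\<omega>\<in>set_pmf P. f S \<omega>) = fredholm_pf L M"
    unfolding fredholm_pf_def I_def[symmetric] using sums by (intro infsum_cong infsumI)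
  moreover have "(\<Sum>\<^sub>\<infinity>S\<in>I. f S \<omega>) = complex_of_real (pmf P \<omega>) * (\<Prod>x\<in>D \<omega> \<inter> M. 1 + w x)"
    if "\<omega> \<in> set_pmf P" for \<omega>
  proof -
    have "(\<Sum>\<^sub>\<infinity>S\<in>I. f S \<omega>) = (\<Sum>\<^sub>\<infinity>S\<in>Pow (D \<omega> \<inter> M). complex_of_real (pmf P \<omega>) * (\<Prod>x\<in>S. w x))"
      using finite_subset[OF _ fin[OF that]] by (intro infsum_cong_neutral) (auto simp: I_def f_def)
    also have "\<dots> = complex_of_real (pmf P \<omega>) * (\<Sum>S\<in>Pow (D \<omega> \<inter> M). \<Prod>x\<in>S. w x)"
      unfolding sum_distrib_left using fin[OF that] by (intro infsum_finite finite_Pow_iff[THEN iffD2])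
    also have "(\<Sum>S\<in>Pow (D \<omega> \<inter> M). \<Prod>x\<in>S. w x) = (\<Prod>x\<in>D \<omega> \<inter> M. 1 + w x)"
      using prod_add[OF fin[OF that], of w "\<lambda>_. 1"] by (simp add: add.commute)
    finally show ?thesis .
  qed
  ultimately show ?thesis by (simp cong: infsum_cong)
qed

section \<open>Charge zero of partitions\<close>

text \<open>From \<open>n0\<close> on all parts vanish and the point with index \<open>k\<close> is
  \<open>- (k + 1)\<close>. A cutoff at \<open>- n\<close> therefore separates the first
  \<open>n\<close> points from the rest, which fill everything below it.\<close>

lemma point_config_window:
  assumes "lam \<in> int_partitions"
  obtains n0 where "\<And>n. n \<ge> n0 \<Longrightarrow> {..<- int n} \<subseteq> point_config lam"
    and "\<And>n. n \<ge> n0 \<Longrightarrow> finite (point_config lam \<inter> {- int n..})"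
    and "\<And>n. n \<ge> n0 \<Longrightarrow> card (point_config lam \<inter> {- int n..}) = n"
proof -
  have anti: "antimono lam" and "finite {k. lam k \<noteq> 0}"
    using assms by (auto simp: int_partitions_def)
  then obtain n0 where n0: "\<And>k. k \<ge> n0 \<Longrightarrow> lam k = 0"
    using finite_nat_set_iff_bounded[of "{k. lam k \<noteq> 0}"] by (metis mem_Collect_eq not_less)
  let ?g = "\<lambda>k. int (lam k) - int (k + 1)"
  have "?g j < ?g i" if "i < j" for i j using antimonoD[OF anti, of i j] that by simp
  then have inj: "inj ?g" by (intro linorder_injI) (metis order_less_irrefl)
  have window: "point_config lam \<inter> {- int n..} = ?g ` {..<n}" if "n \<ge> n0" for n
  proof
    show "point_config lam \<inter> {- int n..} \<subseteq> ?g ` {..<n}"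
    proof
      fix a assume a: "a \<in> point_config lam \<inter> {- int n..}"
      then obtain k where k: "a = ?g k" by (auto simp: point_config_def)
      then have "k < n" using a n0[of k] that by (cases "k < n") auto
      then show "a \<in> ?g ` {..<n}" using k by blast
    qed
  qed (auto simp: point_config_def)
  show ?thesis
  proof
    fix n assume n: "n \<ge> n0"
    show "{..<- int n} \<subseteq> point_config lam"
    proof
      fix a assume "a \<in> {..<- int n}"
      then have "a = ?g (nat (- a - 1))" using n n0[of "nat (- a - 1)"] by auto
      then show "a \<in> point_config lam" unfolding point_config_def by (rule range_eqI)
    qed
    show "finite (point_config lam \<inter> {- int n..})" by (simp add: window[OF n])
    show "card (point_config lam \<inter> {- int n..}) = n"
      unfolding window[OF n] using inj by (subst card_image) (auto intro: inj_on_subset)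
  qed
qed

text \<open>A window \<open>W = {- int n..}\<close> is chosen to contain \<open>N_plus\<close> and
  all holes in \<open>N_minus\<close>. There the configuration has \<open>n\<close> points, and
  \<open>N_minus\<close> is counted against the \<open>n\<close> negative integers of
  \<open>W\<close>. Removing the common part of configuration and \<open>N_minus\<close> from both
  counts gives the relation.\<close>

lemma point_config_balance:
  assumes "lam \<in> int_partitions" and "N_plus \<union> N_minus = UNIV" and "N_plus \<inter> N_minus = {}"
    and fp: "finite (N_plus \<inter> {..<0})" and fm: "finite (N_minus \<inter> {0..})"
  shows "finite (point_config lam \<inter> N_plus)" and "finite (N_minus - point_config lam)"
    and "card (point_config lam \<inter> N_plus) + card (N_minus \<inter> {0..})
         = card (N_minus - point_config lam) + card (N_plus \<inter> {..<0})"
proof -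
  let ?X = "point_config lam"
  from point_config_window[OF assms(1)] obtain n0 where n0:
    "\<And>n. n \<ge> n0 \<Longrightarrow> {..<- int n} \<subseteq> ?X"
    "\<And>n. n \<ge> n0 \<Longrightarrow> finite (?X \<inter> {- int n..})"
    "\<And>n. n \<ge> n0 \<Longrightarrow> card (?X \<inter> {- int n..}) = n" by metis
  obtain b where b: "\<And>a. a \<in> N_plus \<inter> {..<0} \<Longrightarrow> b \<le> a"
    using bdd_below_finite[OF fp] by (auto simp: bdd_below_def)
  \<comment> \<open>The cutoff \<open>- n\<close> is at most \<open>b\<close>, hence at most every
    negative point of \<open>N_plus\<close>, and \<open>n \<ge> n0\<close> makes the configuration
    full below it.\<close>
  define n where "n = max n0 (nat (- b))"
  define W where "W = {- int n..}"
  have sub: "{..<- int n} \<subseteq> ?X" and finX: "finite (?X \<inter> W)" and cardX: "card (?X \<inter> W) = n"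
    using n0[of n] by (auto simp: n_def W_def)
  have pm: "N_plus \<inter> {..<0} \<subseteq> W" using b by (force simp: W_def n_def)
  have pW: "N_plus \<subseteq> W"
  proof
    fix a assume "a \<in> N_plus"
    then show "a \<in> W" using pm by (cases "a < 0") (auto simp: W_def)
  qed
  have mW: "N_minus - ?X \<subseteq> W" using sub unfolding W_def by (meson DiffE atLeast_iff lessThan_iff not_le subsetD subsetI)
  have eq: "N_minus \<inter> W = N_minus \<inter> {0..} \<union> ({- int n..<0} - N_plus \<inter> {..<0})"
    using assms(2,3) by (auto simp: W_def)
  then have finN: "finite (N_minus \<inter> W)" using fm by simp
  show finXp: "finite (?X \<inter> N_plus)" by (rule finite_subset[OF _ finX]) (use pW in auto)
  show finMX: "finite (N_minus - ?X)" by (rule finite_subset[OF _ finN]) (use mW in auto)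
  have "n = card (?X \<inter> N_plus) + card (?X \<inter> W \<inter> N_minus)"
  proof -
    have "?X \<inter> W = (?X \<inter> N_plus) \<union> (?X \<inter> W \<inter> N_minus)" using assms(2) pW by auto
    then have "n = card ((?X \<inter> N_plus) \<union> (?X \<inter> W \<inter> N_minus))" using cardX by simp
    also have "\<dots> = card (?X \<inter> N_plus) + card (?X \<inter> W \<inter> N_minus)"
      using finXp finX assms(3) by (intro card_Un_disjoint) auto
    finally show ?thesis .
  qed
  moreover have "card (N_minus \<inter> W) = card (N_minus - ?X) + card (?X \<inter> W \<inter> N_minus)"
  proof -
    have "N_minus \<inter> W = (N_minus - ?X) \<union> (?X \<inter> W \<inter> N_minus)" using mW by auto
    then have "card (N_minus \<inter> W) = card ((N_minus - ?X) \<union> (?X \<inter> W \<inter> N_minus))" by simp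
    also have "\<dots> = card (N_minus - ?X) + card (?X \<inter> W \<inter> N_minus)"
      using finMX finX by (intro card_Un_disjoint) auto
    finally show ?thesis .
  qed
  moreover have "card (N_minus \<inter> W) = card (N_minus \<inter> {0..}) + (n - card (N_plus \<inter> {..<0}))"
  proof -
    have "N_plus \<inter> {..<0} \<subseteq> {- int n..<0}" using pm by (auto simp: W_def)
    then have "card ({- int n..<0} - N_plus \<inter> {..<0}) = n - card (N_plus \<inter> {..<0})"
      using fp by (subst card_Diff_subset) auto
    moreover have "card (N_minus \<inter> W)
        = card (N_minus \<inter> {0..}) + card ({- int n..<0} - N_plus \<inter> {..<0})"
      unfolding eq using fm by (intro card_Un_disjoint) auto
    ultimately show ?thesis by simp
  qed
  \<comment> \<open>Keeps the natural-number subtraction in the previous count from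
    truncating.\<close>
  moreover have "card (N_plus \<inter> {..<0}) \<le> n"
  proof -
    have "N_plus \<inter> {..<0} \<subseteq> {- int n..<0}" using pm by (auto simp: W_def)
    then have "card (N_plus \<inter> {..<0}) \<le> card {- int n..<0}" by (intro card_mono) auto
    then show ?thesis by simp
  qed
  ultimately show "card (?X \<inter> N_plus) + card (N_minus \<inter> {0..})
      = card (N_minus - ?X) + card (N_plus \<inter> {..<0})" by linarith
qed

section \<open>Power identities under the charge relation\<close>

text \<open>The excess \<open>n - m = q - p\<close> of factors \<open>1 + s\<close> is split off;
  the others pair with the factors \<open>1 - s\<close> to \<open>1 - s\<^sup>2\<close>.\<close>

lemma power_balance:
  fixes s :: complex
  assumes "m + q = n + p" and "1 + s \<noteq> 0"
  shows "(1 - s) ^ m * (1 + s) ^ n = (1 + s) powi (int q - int p) * (1 - s\<^sup>2) ^ m"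
proof -
  have "int n = int q - int p + int m" using assms(1) by simp
  then have "(1 + s) ^ n = (1 + s) powi (int q - int p) * (1 + s) ^ m"
    using assms(2) power_int_add[of "1 + s" "int q - int p" "int m"]
    by (metis power_int_of_nat)
  moreover have "1 - s\<^sup>2 = (1 - s) * (1 + s)" by (simp add: algebra_simps power2_eq_square)
  ultimately show ?thesis by (simp add: power_mult_distrib mult_ac)
qed

text \<open>Now the excess of factors \<open>1 - s\<close> is split off. At \<open>s = 1\<close>
  this base is 0 and a negative \<open>powi\<close> of it would be 0, so there
  \<open>q \<le> p\<close> keeps the exponent nonnegative.\<close>

lemma power_balance_complement:
  fixes s :: complex
  assumes "m + q = n + p" and "1 + s \<noteq> 0" and "s \<noteq> 1 \<or> q \<le> p"
  shows "(1 + s) powi (int q - int p) * (1 - s\<^sup>2) ^ m = (1 - s) powi (int p - int q) * (1 - s\<^sup>2) ^ n"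
proof -
  have split: "1 - s\<^sup>2 = (1 - s) * (1 + s)" by (simp add: algebra_simps power2_eq_square)
  have "(1 - s) ^ m = (1 - s) powi (int p - int q) * (1 - s) ^ n"
  proof (cases "s = 1")
    case True
    then have "m = (p - q) + n" "int p - int q = int (p - q)" using assms by auto
    then show ?thesis by (simp only: power_int_of_nat power_add)
  next
    case False
    have "int m = int p - int q + int n" using assms(1) by simp
    then show ?thesis using False power_int_add[of "1 - s" "int p - int q" "int n"]
      by (metis power_int_of_nat right_minus_eq)
  qed
  then have "(1 - s) powi (int p - int q) * (1 - s\<^sup>2) ^ n = (1 - s) ^ m * (1 + s) ^ n"
    by (simp add: split power_mult_distrib mult_ac)
  then show ?thesis using power_balance[OF assms(1,2)] by simp
qed


section \<open>Comparison of the three Fredholm Pfaffians\<close>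

theorem theorem8p4:
  fixes K :: kern and N_plus N_minus N_pm N_mp :: "int set" and t :: complex
  assumes "antisym_kern K"
    and "represents_partition_distribution K"
    and "N_plus \<union> N_minus = UNIV" and "N_plus \<inter> N_minus = {}"
    and "N_pm = N_plus \<inter> {..<0}" and "N_mp = N_minus \<inter> {0..}"
    and "finite N_pm" and "finite N_mp"
  shows "(fredholm_pf_defined (- conj_kern (csqrt (csqrt t)) (K - proj_kern N_minus J)) UNIV \<and>
          fredholm_pf_defined (- conj_kern (csqrt t) K) N_plus \<longrightarrow>
            fredholm_pf (- conj_kern (csqrt (csqrt t)) (K - proj_kern N_minus J)) UNIV =
            (1 + csqrt t) powi (int (card N_mp) - int (card N_pm)) *
              fredholm_pf (- conj_kern (csqrt t) K) N_plus)
       \<and> (fredholm_pf_defined (- conj_kern (csqrt t) K) N_plus \<and>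
          fredholm_pf_defined (- conj_kern (csqrt t) (J - K)) N_minus \<and>
          (t \<noteq> 1 \<or> card N_mp \<le> card N_pm) \<longrightarrow>
            (1 + csqrt t) powi (int (card N_mp) - int (card N_pm)) *
              fredholm_pf (- conj_kern (csqrt t) K) N_plus =
            (1 - csqrt t) powi (int (card N_pm) - int (card N_mp)) *
              fredholm_pf (- conj_kern (csqrt t) (J - K)) N_minus)"
proof -
  obtain P :: "(nat \<Rightarrow> nat) pmf" where parts: "set_pmf P \<subseteq> int_partitions"
    and rep: "\<And>S. finite S \<Longrightarrow>
      complex_of_real (measure_pmf.prob P {lam. S \<subseteq> point_config lam}) = pf K S"
    using assms(2) by (auto simp: represents_partition_distribution_def)
  define s where "s = csqrt t"
  have ss: "s\<^sup>2 = t" "csqrt s * csqrt s = s" "s * s = t"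
    by (simp_all add: s_def flip: power2_eq_square)
  \<comment> \<open>The principal square root lies in the right half-plane, so it is never
    -1.\<close>
  have "Re s \<ge> 0" unfolding s_def by (rule Re_csqrt)
  then have s1: "1 + s \<noteq> 0" by (auto simp: complex_eq_iff)
  have s_eq_1: "s \<noteq> 1" if "t \<noteq> 1" using that ss by auto
  let ?m = "\<lambda>lam. card (point_config lam \<inter> N_plus)"
  let ?n = "\<lambda>lam. card (N_minus - point_config lam)"
  have fin: "finite (point_config lam \<inter> N_plus)" "finite (N_minus - point_config lam)"
    and bal: "?m lam + card N_mp = ?n lam + card N_pm" if "lam \<in> set_pmf P" for lam
    using point_config_balance[of lam N_plus N_minus] that parts assms by auto
  let ?L = "- conj_kern (csqrt (csqrt t)) (K - proj_kern N_minus J)"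
  let ?L1 = "- conj_kern (csqrt t) K"
  let ?L2 = "- conj_kern (csqrt t) (J - K)"
  have first: "fredholm_pf ?L UNIV = (\<Sum>\<^sub>\<infinity>lam\<in>set_pmf P. complex_of_real (pmf P lam) *
      ((1 - s) ^ ?m lam * (1 + s) ^ ?n lam))" if "fredholm_pf_defined ?L UNIV"
  proof -
    let ?D = "\<lambda>lam. (point_config lam - N_minus) \<union> (N_minus - point_config lam)"
    \<comment> \<open>The weight is \<open>- s\<close> on \<open>N_plus\<close> and \<open>s\<close>
      on \<open>N_minus\<close>: each particle in \<open>N_plus\<close> yields \<open>1 - s\<close>,
      each hole in \<open>N_minus\<close> yields \<open>1 + s\<close>.\<close>
    let ?w = "\<lambda>x. - s * (if x \<in> N_minus then - 1 else 1)"
    have D: "?D lam = (point_config lam \<inter> N_plus) \<union> (N_minus - point_config lam)" for lam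
      using assms(3,4) by auto
    have entry: "?L a b $ i $ j = - s * (K - proj_kern N_minus J) a b $ i $ j" for a b i j
      by (simp add: conj_kern_def s_def[symmetric] mult_ac ss flip: mult.assoc)
    have "fredholm_pf ?L UNIV = (\<Sum>\<^sub>\<infinity>lam\<in>set_pmf P. complex_of_real (pmf P lam) *
        (\<Prod>x\<in>?D lam \<inter> UNIV. 1 + ?w x))"
      using that
    proof (rule fredholm_pf_eq_expectation[rotated])
      fix S :: "int set" assume "finite S"
      then show "pf ?L S = (\<Prod>x\<in>S. ?w x) *
          complex_of_real (measure_pmf.prob P {lam. S \<subseteq> ?D lam})"
        by (simp only: pf_scale[OF _ entry] pf_minus_projection[OF rep] prod.distrib prod_constant
            mult.assoc)
    qed (use fin in \<open>simp add: D\<close>)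
    also have "\<dots> = (\<Sum>\<^sub>\<infinity>lam\<in>set_pmf P. complex_of_real (pmf P lam) *
        ((1 - s) ^ ?m lam * (1 + s) ^ ?n lam))"
    proof (rule infsum_cong)
      fix lam assume "lam \<in> set_pmf P"
      then have "(\<Prod>x\<in>?D lam \<inter> UNIV. 1 + ?w x)
          = (\<Prod>x\<in>point_config lam \<inter> N_plus. 1 + ?w x) * (\<Prod>x\<in>N_minus - point_config lam. 1 + ?w x)"
        unfolding D Int_UNIV_right using fin by (intro prod.union_disjoint) auto
      also have "(\<Prod>x\<in>point_config lam \<inter> N_plus. 1 + ?w x) = (\<Prod>x\<in>point_config lam \<inter> N_plus. 1 - s)"
        using assms(4) by (intro prod.cong) auto
      finally show "complex_of_real (pmf P lam) * (\<Prod>x\<in>?D lam \<inter> UNIV. 1 + ?w x)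
          = complex_of_real (pmf P lam) * ((1 - s) ^ ?m lam * (1 + s) ^ ?n lam)"
        by simp
    qed
    finally show ?thesis .
  qed
  have second: "fredholm_pf ?L1 N_plus = (\<Sum>\<^sub>\<infinity>lam\<in>set_pmf P. complex_of_real (pmf P lam) *
      (1 - s\<^sup>2) ^ ?m lam)" if "fredholm_pf_defined ?L1 N_plus"
  proof -
    have entry: "?L1 a b $ i $ j = - t * K a b $ i $ j" for a b i j
      by (simp add: conj_kern_def s_def[symmetric] mult_ac ss flip: mult.assoc)
    have "fredholm_pf ?L1 N_plus = (\<Sum>\<^sub>\<infinity>lam\<in>set_pmf P. complex_of_real (pmf P lam) *
        (\<Prod>x\<in>point_config lam \<inter> N_plus. 1 + - t))"
      using that
    proof (rule fredholm_pf_eq_expectation[rotated])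
      fix S :: "int set" assume "finite S"
      then show "pf ?L1 S = (\<Prod>x\<in>S. - t) *
          complex_of_real (measure_pmf.prob P {lam. S \<subseteq> point_config lam})"
        by (simp only: pf_scale[OF _ entry] rep prod_constant)
    qed (use fin in simp)
    then show ?thesis by (simp add: ss)
  qed
  have third: "fredholm_pf ?L2 N_minus = (\<Sum>\<^sub>\<infinity>lam\<in>set_pmf P. complex_of_real (pmf P lam) *
      (1 - s\<^sup>2) ^ ?n lam)" if "fredholm_pf_defined ?L2 N_minus"
  proof -
    \<comment> \<open>With \<open>N = UNIV\<close> the projection of \<open>J\<close> is
      \<open>J\<close> itself, so \<open>- (J - K)\<close> has the form of
      \<open>pf_minus_projection\<close>, and the random set is the complement of the
      configuration.\<close>
    let ?D = "\<lambda>lam. (point_config lam - UNIV) \<union> (UNIV - point_config lam)"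
    have D: "?D lam \<inter> N_minus = N_minus - point_config lam" for lam by auto
    have entry: "?L2 a b $ i $ j = t * (K - proj_kern UNIV J) a b $ i $ j" for a b i j
      by (simp add: conj_kern_def proj_kern_def s_def[symmetric] mult_ac ss algebra_simps
          flip: mult.assoc)
    have "fredholm_pf ?L2 N_minus = (\<Sum>\<^sub>\<infinity>lam\<in>set_pmf P. complex_of_real (pmf P lam) *
        (\<Prod>x\<in>?D lam \<inter> N_minus. 1 + t * (if x \<in> UNIV then - 1 else 1)))"
      using that
    proof (rule fredholm_pf_eq_expectation[rotated])
      fix S :: "int set" assume "finite S"
      then show "pf ?L2 S = (\<Prod>x\<in>S. t * (if x \<in> UNIV then - 1 else 1)) *
          complex_of_real (measure_pmf.prob P {lam. S \<subseteq> ?D lam})"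
        by (simp only: pf_scale[OF _ entry] pf_minus_projection[OF rep] prod.distrib prod_constant
            mult.assoc)
    qed (use fin in \<open>simp only: D\<close>)
    then show ?thesis unfolding D by (simp add: ss)
  qed
  \<comment> \<open>The charge relation makes the prefactor independent of \<open>lam\<close>, so it
    moves inside the series and the terms agree one by one.\<close>
  have "fredholm_pf ?L UNIV = (1 + s) powi (int (card N_mp) - int (card N_pm)) * fredholm_pf ?L1 N_plus"
    if "fredholm_pf_defined ?L UNIV" "fredholm_pf_defined ?L1 N_plus"
    unfolding first[OF that(1)] second[OF that(2)] infsum_cmult_right'[symmetric]
    by (intro infsum_cong) (simp add: power_balance[OF bal s1] mult.left_commute)
  moreover have "(1 + s) powi (int (card N_mp) - int (card N_pm)) * fredholm_pf ?L1 N_plus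
      = (1 - s) powi (int (card N_pm) - int (card N_mp)) * fredholm_pf ?L2 N_minus"
    if "fredholm_pf_defined ?L1 N_plus" "fredholm_pf_defined ?L2 N_minus"
      and t: "t \<noteq> 1 \<or> card N_mp \<le> card N_pm"
  proof -
    have "s \<noteq> 1 \<or> card N_mp \<le> card N_pm" using t s_eq_1 by blast
    note pb = power_balance_complement[OF bal s1 this]
    show ?thesis
      unfolding second[OF that(1)] third[OF that(2)] infsum_cmult_right'[symmetric]
      by (intro infsum_cong) (simp only: pb mult.left_commute)
  qed
  ultimately show ?thesis unfolding s_def by blast
qed

end
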